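(* Let $K,N\ge1$ be integers with $K$ dividing $N$, and consider the data shuffling problem with $N$ files, a master node and $K$ worker nodes, each with a cache of size $S$ files such that $\widehat S=S/(N/K)\in[K]$ is an integer. The communication load required to shuffle the $N$ files among the worker nodes according to the worst-case shuffling is $$R_{\text{worst-case}}=\frac NK\,\frac{\binom{K-1}{\widehat S}}{\binom{K-1}{\widehat S-1}}.$$
   Context: Notation: $[K]=\{1,\dots,K\}$; $\binom{n}{k}=0$ when $n<k$. Data shuffling problem ($K\mid N$, so $N\ge K$). There are $N$ files $F^1,\dots,F^N$, each a string of $B$ bits ($B$ a positive integer; the files are independent and uniformly distributed); the size of a file is normalized to $1$, i.e. sizes are measured in units of $B$ bits. There are $K$ worker nodes $W_1,\dots,W_K$ and a master node that knows all files. At iteration $t$ worker $W_i$ processes, and stores completely, the $N/K$ files with indices in $u(i)=\{(i-1)N/K+\ell:\ell\in[N/K]\}$. Each worker has a cache of size $S$ files, $N/K\le S\le N$. An uncoded placement (with cache size $S$, file length $B$) specifies for each worker $W_i$ and each file $F^j$ with $j\notin u(i)$ a set of bits (bit positions) of $F^j$ stored in the excess storage of $W_i$, with at most $(S-N/K)B$ excess bits in total for each worker. The cache content $\mathcal Z_i$ consists of the files in $u(i)$ and the excess bits. The placement is chosen without knowledge of the next assignment (it is the same for all $d$). An assignment $d$ is an ordered partition $(d(1),\dots,d(K))$ of $[N]$ into blocks of size $N/K$: at iteration $t+1$ worker $W_i$ must process the files with indices in $d(i)$. A delivery for $d$ of load $L/B$ is a function $\mathcal X$ of all files with values in $\{0,1\}^L$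 (broadcast by the master to all workers without error) such that for each $i\in[K]$ all files $F^j$, $j\in d(i)$, are functions of $(\mathcal X,\mathcal Z_i)$. For a placement $P$, let $R(P;d)$ be the minimum load of a delivery for $d$. The worst-case load is $R_{\text{worst-case}}=\inf_{B,P}\max_d R(P;d)$, the infimum being over all file lengths $B$ and all uncoded placements $P$ with cache size $S$, and the maximum over all assignments $d$. *)

theory Defs
  imports Complex_Main "HOL-Library.FuncSet" "HOL-Library.Disjoint_Sets"
begin

(* K workers indexed by {1..K}, N files indexed by {1..N}, each file a string of B bits at
   positions {..<B}.  Being "a function of" is exact recovery for every realization of the
   files; under the uniform distribution all realizations have positive probability, so the
   distribution does not enter the definitions. *)

definition file_contents :: "nat \<Rightarrow> nat \<Rightarrow> (nat \<Rightarrow> bool list) set" where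
  "file_contents N B = {1..N} \<rightarrow>\<^sub>E {bs. length bs = B}"

definition processed :: "nat \<Rightarrow> nat \<Rightarrow> nat \<Rightarrow> nat set" where
  "processed K N i = (\<lambda>l. (i - 1) * (N div K) + l) ` {1..N div K}"

(* P i j is the set of positions of the bits of file j kept in the excess storage of worker i;
   only its values for i in {1..K} and j not in processed K N i matter. *)

definition uncoded_placement ::
  "nat \<Rightarrow> nat \<Rightarrow> real \<Rightarrow> nat \<Rightarrow> (nat \<Rightarrow> nat \<Rightarrow> nat set) \<Rightarrow> bool" where
  "uncoded_placement K N S B P \<longleftrightarrow>
     (\<forall>i\<in>{1..K}.
        (\<forall>j\<in>{1..N} - processed K N i. P i j \<subseteq> {..<B}) \<and>
        real (\<Sum>j\<in>{1..N} - processed K N i. card (P i j)) \<le> (S - real N / real K) * real B)"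

definition cache_content ::
  "nat \<Rightarrow> nat \<Rightarrow> (nat \<Rightarrow> nat \<Rightarrow> nat set) \<Rightarrow> nat \<Rightarrow> (nat \<Rightarrow> bool list)
     \<Rightarrow> (nat \<Rightarrow> bool list) \<times> (nat \<times> nat \<Rightarrow> bool)" where
  "cache_content K N P i F =
     (restrict F (processed K N i),
      restrict (\<lambda>(j, b). F j ! b) (Sigma ({1..N} - processed K N i) (P i)))"

definition assignments :: "nat \<Rightarrow> nat \<Rightarrow> (nat \<Rightarrow> nat set) set" where
  "assignments K N =
     {d \<in> {1..K} \<rightarrow>\<^sub>E Pow {1..N}.
        (\<forall>i\<in>{1..K}. card (d i) = N div K) \<and>
        disjoint_family_on d {1..K} \<and>
        (\<Union>i\<in>{1..K}. d i) = {1..N}}"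

definition delivery ::
  "nat \<Rightarrow> nat \<Rightarrow> nat \<Rightarrow> (nat \<Rightarrow> nat \<Rightarrow> nat set) \<Rightarrow> (nat \<Rightarrow> nat set) \<Rightarrow> nat
     \<Rightarrow> ((nat \<Rightarrow> bool list) \<Rightarrow> bool list) \<Rightarrow> bool" where
  "delivery K N B P d L X \<longleftrightarrow>
     (\<forall>F\<in>file_contents N B. length (X F) = L) \<and>
     (\<forall>i\<in>{1..K}. \<forall>j\<in>d i. \<exists>decode. \<forall>F\<in>file_contents N B.
        F j = decode (X F, cache_content K N P i F))"

(* The minimum exists: broadcasting all files is a delivery with L = N * B. *)

definition min_load ::
  "nat \<Rightarrow> nat \<Rightarrow> nat \<Rightarrow> (nat \<Rightarrow> nat \<Rightarrow> nat set) \<Rightarrow> (nat \<Rightarrow> nat set) \<Rightarrow> real" where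
  "min_load K N B P d = real (LEAST L. \<exists>X. delivery K N B P d L X) / real B"

definition R_worst_case :: "nat \<Rightarrow> nat \<Rightarrow> real \<Rightarrow> real" where
  "R_worst_case K N S =
     Inf {Max (min_load K N B P ` assignments K N) |B P. B > 0 \<and> uncoded_placement K N S B P}"

end

theory Submission
  imports Defs "HOL-Library.Z2" "HOL-Combinatorics.Permutations"
begin

text \<open>
  Converse: order the workers by a permutation and let each worker request the block of its
  successor. From the broadcast and the cache of the first worker one decodes the block of the
  second, then from its cache the block of the third, and so on; hence the load is at least the
  number of bits, outside the first block, that are cached by no worker preceding the owner of
  their file. A bit cached by \<open>h\<close> workers besides the owner counts in a proportion
  \<open>1/(h+1) - 1/K\<close> of all orders. Averaging over the orders, convexity of \<open>1/x\<close> and the bound on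
  the total excess storage give \<open>N (1/s - 1/K)\<close>, where \<open>s\<close> is the normalized cache size.

  Achievability: each file has one bit for each set of \<open>s - 1\<close> non-owners, cached by that
  set. With \<open>Y T\<close> the sum over GF(2) of the bits that members of an \<open>(s+1)\<close>-set \<open>T\<close> want and
  all the others in \<open>T\<close> have, one broadcasts the simplicial boundary of \<open>Y\<close> at \<open>s\<close>-sets. As
  the boundary of a boundary vanishes, the \<open>s\<close>-sets avoiding one fixed worker suffice. A worker
  \<open>i\<close> reads the bit labelled \<open>G\<close> of its request off the boundary at \<open>insert i G\<close>, in which it
  knows every other term.
\<close>

section \<open>Boundaries over GF(2)\<close>

declare add_bit_eq_xor [simp del]

lemma bit_add_self: "(a :: bit) + a = 0"
  by (cases a) (auto simp: add_bit_eq_xor)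

text \<open>In characteristic 2 the terms at (i, j) and (j, i) cancel. The induction step adds one
  row and one column, which are equal.\<close>

lemma sum_distinct_pairs_bit:
  fixes g :: "'a \<Rightarrow> 'a \<Rightarrow> bit"
  assumes "finite V" and "\<And>i j. g i j = g j i"
  shows "(\<Sum>i\<in>V. \<Sum>j\<in>V - {i}. g i j) = 0"
  using assms(1)
proof induction
  case (insert a V)
  have "(\<Sum>i\<in>V. \<Sum>j\<in>insert a V - {i}. g i j) = (\<Sum>i\<in>V. g i a + (\<Sum>j\<in>V - {i}. g i j))"
  proof (rule sum.cong)
    fix i assume "i \<in> V"
    then have "insert a V - {i} = insert a (V - {i})" using insert.hyps by auto
    then show "(\<Sum>j\<in>insert a V - {i}. g i j) = g i a + (\<Sum>j\<in>V - {i}. g i j)"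
      using insert.hyps by simp
  qed simp
  also have "\<dots> = (\<Sum>i\<in>V. g i a)"
    using insert.IH by (simp add: sum.distrib)
  also have "\<dots> = (\<Sum>i\<in>V. g a i)"
    by (intro sum.cong assms(2)) simp
  finally show ?case
    using insert.hyps by (simp add: add.assoc[symmetric] bit_add_self)
qed simp

text \<open>The mod 2 boundary operator of the full simplex on \<open>W\<close>, coefficientwise:
  for \<open>D\<close> contained in \<open>W\<close>, the value is the coefficient of the face
  \<open>D\<close> in the boundary of the chain \<open>y\<close>.\<close>

definition boundary :: "'a set \<Rightarrow> ('a set \<Rightarrow> bit) \<Rightarrow> 'a set \<Rightarrow> bit" where
  "boundary W y D = (\<Sum>j\<in>W - D. y (insert j D))"

text \<open>Two vertices can be added to \<open>D\<close> in either order, so every term occurs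
  twice.\<close>

lemma boundary_boundary:
  assumes "finite W"
  shows "boundary W (boundary W y) D = 0"
proof -
  have "W - insert i D = (W - D) - {i}" for i by auto
  then have "boundary W (boundary W y) D
      = (\<Sum>i\<in>W - D. \<Sum>j\<in>(W - D) - {i}. y (insert j (insert i D)))"
    by (simp add: boundary_def)
  also have "\<dots> = 0"
    using assms by (intro sum_distinct_pairs_bit) (auto simp: insert_commute)
  finally show ?thesis .
qed

text \<open>Faces through \<open>k\<close> are redundant: for \<open>D = insert k C\<close>, the
  vanishing double boundary at \<open>C\<close> writes the value at \<open>D\<close> as a sum of
  values at faces avoiding \<open>k\<close>.\<close>

lemma boundary_zero_extend:
  assumes "finite W" "k \<in> W" "D \<subseteq> W" "card D = s"
    and zero: "\<And>D. D \<subseteq> W - {k} \<Longrightarrow> card D = s \<Longrightarrow> boundary W y D = 0"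
  shows "boundary W y D = 0"
proof (cases "k \<in> D")
  case True
  define C where "C = D - {k}"
  have D: "D = insert k C" "k \<notin> C" "C \<subseteq> W" "finite C"
    using True assms by (auto simp: C_def intro: finite_subset)
  have "boundary W y (insert i C) = 0" if "i \<in> W - C - {k}" for i
    using that D assms(4) by (intro zero) auto
  moreover have "boundary W (boundary W y) C
      = boundary W y (insert k C) + (\<Sum>i\<in>W - C - {k}. boundary W y (insert i C))"
    unfolding boundary_def[of W "boundary W y"]
    using D assms by (intro sum.remove) auto
  ultimately show ?thesis
    using boundary_boundary[OF assms(1), of y C] D by simp
next
  case False
  then show ?thesis using assms by (intro zero) auto
qed

text \<open>Here \<open>r i\<close> is the file requested by worker \<open>i\<close>, and \<open>v f A\<close> is the bit of file \<open>f\<close> cached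
  by the workers in \<open>A\<close>.\<close>

definition group_sum ::
  "('b \<Rightarrow> 'a) \<Rightarrow> ('a \<Rightarrow> 'b) \<Rightarrow> ('b \<Rightarrow> 'a set \<Rightarrow> bit) \<Rightarrow> 'a set \<Rightarrow> bit" where
  "group_sum own r v T =
     (\<Sum>i\<in>T. if own (r i) \<in> T - {i} then v (r i) (T - {i, own (r i)}) else 0)"

lemma group_sum_add:
  "group_sum own r (\<lambda>f A. v f A + w f A) T = group_sum own r v T + group_sum own r w T"
  unfolding group_sum_def sum.distrib[symmetric] by (intro sum.cong) auto

text \<open>Additivity allows the difference of two file contents to be treated as a single family
  of bits.\<close>

lemma boundary_group_sum_add:
  "boundary W (group_sum own r (\<lambda>f A. v f A + w f A)) D
     = boundary W (group_sum own r v) D + boundary W (group_sum own r w) D"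
  by (simp add: boundary_def group_sum_add sum.distrib)

text \<open>Decoding by worker \<open>i\<close>: in every group containing \<open>i\<close> only the
  term of \<open>i\<close> itself can survive. Since \<open>G\<close> misses the owner of the
  request, that term is present for exactly one added vertex, namely this owner, and its label is
  then \<open>G\<close>.\<close>

lemma boundary_group_sum_single:
  assumes "finite W" "i \<in> W" "own (r i) \<in> W" "own (r i) \<noteq> i"
    and G: "G \<subseteq> W - {i, own (r i)}"
    and known: "\<And>k A. k \<in> W \<Longrightarrow> own (r k) = i \<or> i \<in> A \<Longrightarrow> v (r k) A = 0"
  shows "boundary W (group_sum own r v) (insert i G) = v (r i) G"
proof -
  have "group_sum own r v (insert j (insert i G)) = (if j = own (r i) then v (r i) G else 0)"
    if j: "j \<in> W - insert i G" for j
  proof -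
    define T where "T = insert j (insert i G)"
    have T: "finite T" "i \<in> T" "T \<subseteq> W"
      using assms(1,2) G j by (auto simp: T_def intro: finite_subset)
    have "group_sum own r v T
        = (if own (r i) \<in> T - {i} then v (r i) (T - {i, own (r i)}) else 0)
          + (\<Sum>k\<in>T - {i}. if own (r k) \<in> T - {k} then v (r k) (T - {k, own (r k)}) else 0)"
      unfolding group_sum_def using T by (intro sum.remove)
    \<comment> \<open>If \<open>i\<close> does not own the file requested by \<open>k\<close>, it
      stays in the label of the term of \<open>k\<close>; in both cases \<open>known\<close>
      applies.\<close>
    also have "(\<Sum>k\<in>T - {i}. if own (r k) \<in> T - {k} then v (r k) (T - {k, own (r k)}) else 0) = 0"
      using T by (intro sum.neutral) (auto intro!: known)
    finally have "group_sum own r v T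
        = (if own (r i) \<in> T - {i} then v (r i) (T - {i, own (r i)}) else 0)" by simp
    moreover have "own (r i) \<in> T - {i} \<longleftrightarrow> j = own (r i)"
      using assms(4) G by (auto simp: T_def)
    moreover have "T - {i, own (r i)} = G" if "j = own (r i)"
      using G that by (auto simp: T_def)
    ultimately show ?thesis by (auto simp: T_def)
  qed
  then have "boundary W (group_sum own r v) (insert i G)
      = (\<Sum>j\<in>W - insert i G. if j = own (r i) then v (r i) G else 0)"
    unfolding boundary_def by (intro sum.cong) auto
  also have "\<dots> = v (r i) G"
    using assms by (auto simp: sum.delta')
  finally show ?thesis .
qed

section \<open>Counting\<close>

text \<open>By symmetry, each of the \<open>card G + 1\<close> elements of \<open>insert a G\<close> is equally often the first.\<close>

lemma card_permutes_first:
  fixes W :: "nat set"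
  assumes "finite W" "G \<subseteq> W" "a \<in> W - G"
  shows "card {p. p permutes W \<and> (\<forall>g\<in>G. p a < p g)} * (card G + 1) = fact (card W)"
proof -
  define A where "A = insert a G"
  define E where "E x = {p. p permutes W \<and> (\<forall>g\<in>A - {x}. p x < p g)}" for x
  have A: "finite A" "A \<subseteq> W" "A \<noteq> {}" "card A = card G + 1"
    using assms by (auto simp: A_def intro: finite_subset dest: finite_subset)
  have finE: "finite (E x)" for x
    using finite_permutations[OF assms(1)] by (auto simp: E_def intro: finite_subset[rotated])
  have card_E: "card (E x) = card (E a)" if "x \<in> A" for x
  proof -
    \<comment> \<open>Exchanging the positions of \<open>y\<close> and \<open>z\<close> turns an
      order with \<open>y\<close> first into one with \<open>z\<close> first.\<close>
    have sub: "(\<lambda>p. p \<circ> transpose y z) ` E y \<subseteq> E z" if "y \<in> A" "z \<in> A" for y z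
    proof clarify
      fix p assume p: "p \<in> E y"
      have "p \<circ> transpose y z permutes W"
        using p that A by (intro permutes_compose permutes_swap_id) (auto simp: E_def)
      then show "p \<circ> transpose y z \<in> E z"
        using p that by (auto simp: E_def transpose_def)
    qed
    have "bij_betw (\<lambda>p. p \<circ> transpose a x) (E a) (E x)"
    proof (rule bij_betw_byWitness[where f' = "\<lambda>p. p \<circ> transpose x a"])
      show "(\<lambda>p. p \<circ> transpose a x) ` E a \<subseteq> E x" "(\<lambda>p. p \<circ> transpose x a) ` E x \<subseteq> E a"
        using that by (auto intro!: sub[THEN subsetD] simp: A_def)
    qed (auto simp: fun_eq_iff transpose_commute[of x a])
    then show ?thesis by (simp add: bij_betw_same_card)
  qed
  have "{p. p permutes W} = (\<Union>x\<in>A. E x)"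
  proof
    show "{p. p permutes W} \<subseteq> (\<Union>x\<in>A. E x)"
    proof clarify
      fix p assume p: "p permutes W"
      define x where "x = arg_min_on p A"
      have x: "x \<in> A" "\<And>g. g \<in> A \<Longrightarrow> p x \<le> p g"
        using A arg_min_if_finite[of A p] by (auto simp: x_def arg_min_least)
      have "p x < p g" if "g \<in> A - {x}" for g
      proof -
        have "p x \<noteq> p g" using that inj_onD[OF permutes_inj[OF p], of x g] by auto
        then show ?thesis using x(2)[of g] that by simp
      qed
      then show "p \<in> (\<Union>x\<in>A. E x)"
        using p x by (auto simp: E_def)
    qed
  qed (auto simp: E_def)
  then have "fact (card W) = card (\<Union>x\<in>A. E x)"
    using card_permutations[OF refl assms(1)] by simp
  also have "\<dots> = (\<Sum>x\<in>A. card (E x))"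
  proof (rule card_UN_disjoint)
    show "\<forall>x\<in>A. \<forall>y\<in>A. x \<noteq> y \<longrightarrow> E x \<inter> E y = {}"
    proof (intro ballI impI equals0I)
      fix x y p assume "x \<in> A" "y \<in> A" "x \<noteq> y" "p \<in> E x \<inter> E y"
      then have "p x < p y" "p y < p x" by (auto simp: E_def)
      then show False by simp
    qed
  qed (use A finE in auto)
  also have "\<dots> = card (E a) * (card G + 1)"
    using card_E A by simp
  also have "E a = {p. p permutes W \<and> (\<forall>g\<in>G. p a < p g)}"
    using assms(3) by (auto simp: E_def A_def)
  finally show ?thesis by simp
qed

text \<open>Removing \<open>i\<close> leaves an (s-1)-subset of \<open>V - {i}\<close>, and the
  absorption identity for binomials applies. The product form avoids division.\<close>

lemma card_subsets_containing:
  assumes "finite V" "i \<in> V"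
  shows "card V * card {A. A \<subseteq> V \<and> card A = s \<and> i \<in> A} = s * (card V choose s)"
proof (cases s)
  case 0
  have "{A. A \<subseteq> V \<and> card A = s \<and> i \<in> A} = {}"
    using 0 finite_subset[OF _ assms(1)] by auto
  then show ?thesis using 0 by (metis card.empty mult_0 mult_0_right)
next
  case (Suc t)
  have "bij_betw (insert i) {A. A \<subseteq> V - {i} \<and> card A = t} {A. A \<subseteq> V \<and> card A = s \<and> i \<in> A}"
  proof (rule bij_betw_byWitness[where f' = "\<lambda>A. A - {i}"])
    show "insert i ` {A. A \<subseteq> V - {i} \<and> card A = t} \<subseteq> {A. A \<subseteq> V \<and> card A = s \<and> i \<in> A}"
    proof (rule image_subsetI, unfold mem_Collect_eq, elim conjE)
      fix A assume A: "A \<subseteq> V - {i}" "card A = t"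
      then have "finite A" "i \<notin> A" using assms finite_subset by auto
      then show "insert i A \<subseteq> V \<and> card (insert i A) = s \<and> i \<in> insert i A"
        using A assms Suc by auto
    qed
  qed (use Suc assms in \<open>auto simp: card_Diff_singleton_if\<close>)
  then have "card {A. A \<subseteq> V \<and> card A = s \<and> i \<in> A} = (card V - 1) choose t"
    using n_subsets[of "V - {i}" t] assms by (simp add: bij_betw_same_card[symmetric])
  moreover have "card V > 0" using assms by (auto simp: card_gt_0_iff)
  ultimately show ?thesis
    using Suc times_binomial_minus1_eq[of s "card V"] by simp
qed

section \<open>Deliveries and minimum load\<close>

text \<open>A decoder exists iff broadcast and cache together determine the file: it may then pick
  any realization compatible with what it sees.\<close>

lemma delivery_iff:
  "delivery K N B P d L X \<longleftrightarrow>
     (\<forall>F\<in>file_contents N B. length (X F) = L) \<and>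
     (\<forall>i\<in>{1..K}. \<forall>j\<in>d i. \<forall>F\<in>file_contents N B. \<forall>F'\<in>file_contents N B.
        X F = X F' \<longrightarrow> cache_content K N P i F = cache_content K N P i F' \<longrightarrow> F j = F' j)"
proof -
  have "(\<exists>decode. \<forall>F\<in>C. F j = decode (X F, Z F)) \<longleftrightarrow>
      (\<forall>F\<in>C. \<forall>F'\<in>C. X F = X F' \<longrightarrow> Z F = Z F' \<longrightarrow> F j = F' j)" (is "?l \<longleftrightarrow> ?r")
    for j and Z :: "(nat \<Rightarrow> bool list) \<Rightarrow> (nat \<Rightarrow> bool list) \<times> (nat \<times> nat \<Rightarrow> bool)" and C
  proof
    assume r: ?r
    define decode where "decode y = (SOME F. F \<in> C \<and> (X F, Z F) = y) j" for y
    have "F j = decode (X F, Z F)" if F: "F \<in> C" for F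
    proof -
      define G where "G = (SOME F'. F' \<in> C \<and> (X F', Z F') = (X F, Z F))"
      have "G \<in> C \<and> (X G, Z G) = (X F, Z F)"
        unfolding G_def by (rule someI[of _ F]) (use F in simp)
      then have "F j = G j" using r F by (metis prod.inject)
      then show ?thesis by (simp add: decode_def G_def)
    qed
    then show ?l by blast
  qed metis
  then show ?thesis unfolding delivery_def by simp
qed

lemma cache_content_eq_iff:
  "cache_content K N P i F = cache_content K N P i F' \<longleftrightarrow>
     (\<forall>j\<in>processed K N i. F j = F' j) \<and>
     (\<forall>j\<in>{1..N} - processed K N i. \<forall>b\<in>P i j. F j ! b = F' j ! b)"
  unfolding cache_content_def by (auto simp: fun_eq_iff restrict_def)

lemma length_file: "F \<in> file_contents N B \<Longrightarrow> j \<in> {1..N} \<Longrightarrow> length (F j) = B"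
  by (auto simp: file_contents_def)

lemma delivery_exists:
  assumes "B > 0" and d: "\<And>i. i \<in> {1..K} \<Longrightarrow> d i \<subseteq> {1..N}"
  shows "\<exists>L X. delivery K N B P d L X"
proof -
  \<comment> \<open>All files are concatenated: bit \<open>b\<close> of file \<open>j\<close> sits
    at position \<open>(j - 1) * B + b\<close>, as files are numbered from 1.\<close>
  define X where "X F = map (\<lambda>m. F (m div B + 1) ! (m mod B)) [0..<N * B]"
    for F :: "nat \<Rightarrow> bool list"
  have "F j = F' j" if F: "F \<in> file_contents N B" "F' \<in> file_contents N B" and X: "X F = X F'"
    and j: "j \<in> {1..N}" for F F' j
  proof (rule nth_equalityI)
    fix b assume "b < length (F j)"
    then have b: "b < B" using F j by (simp add: length_file)
    have "(j - 1) * B + b < (j - 1) * B + B" using b by simp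
    also have "\<dots> = j * B" using j by (cases j) auto
    also have "\<dots> \<le> N * B" using j by simp
    finally have m: "(j - 1) * B + b < N * B" .
    have "\<forall>m<N * B. F (m div B + 1) ! (m mod B) = F' (m div B + 1) ! (m mod B)"
      using X by (auto simp: X_def)
    from this[rule_format, OF m] show "F j ! b = F' j ! b"
      using b j by simp
  qed (use F j in \<open>simp add: length_file\<close>)
  then have "delivery K N B P d (N * B) X"
    unfolding delivery_iff using d by (intro conjI ballI impI) (simp add: X_def, blast)
  then show ?thesis by blast
qed

lemma min_load_attained:
  assumes "B > 0" "d \<in> assignments K N"
  obtains L X where "delivery K N B P d L X" "min_load K N B P d = real L / real B"
proof -
  have "\<exists>L X. delivery K N B P d L X"
    using assms by (intro delivery_exists) (auto simp: assignments_def PiE_iff)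
  then show ?thesis
    using that LeastI_ex[of "\<lambda>L. \<exists>X. delivery K N B P d L X"] unfolding min_load_def by blast
qed

lemma min_load_le: "delivery K N B P d L X \<Longrightarrow> min_load K N B P d \<le> real L / real B"
  unfolding min_load_def by (intro divide_right_mono of_nat_mono Least_le) auto

lemma finite_assignments: "finite (assignments K N)"
  by (rule finite_subset[of _ "{1..K} \<rightarrow>\<^sub>E Pow {1..N}"])
    (auto simp: assignments_def intro!: finite_PiE)

section \<open>Ownership of files\<close>

locale shuffling =
  fixes K N :: nat
  assumes K_pos: "K \<ge> 1" and N_pos: "N \<ge> 1" and K_dvd_N: "K dvd N"
begin

abbreviation block_size :: nat where
  "block_size \<equiv> N div K"

definition owner :: "nat \<Rightarrow> nat" where
  "owner j = (j - 1) div block_size + 1"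

lemma N_eq: "N = K * block_size"
  using K_dvd_N by simp

lemma block_size_pos: "block_size > 0"
  using N_eq N_pos by (cases "block_size = 0") auto

lemma owner_in: "j \<in> {1..N} \<Longrightarrow> owner j \<in> {1..K}"
proof -
  assume "j \<in> {1..N}"
  then have "j - 1 < K * block_size" using N_eq N_pos by auto
  then have "(j - 1) div block_size < K" using block_size_pos by (simp add: less_mult_imp_div_less)
  then show ?thesis by (simp add: owner_def)
qed

text \<open>Division of \<open>j - 1\<close> by the block size with remainder: the quotient gives
  the block and the remainder the place in it.\<close>

lemma processed_iff:
  assumes "i \<in> {1..K}"
  shows "j \<in> processed K N i \<longleftrightarrow> j \<in> {1..N} \<and> owner j = i"
proof
  assume "j \<in> processed K N i"
  then obtain l where l: "l \<in> {1..block_size}" "j = (i - 1) * block_size + l"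
    unfolding processed_def by blast
  have "j - 1 = (l - 1) + block_size * (i - 1)" using l by (auto simp: mult.commute)
  then have "(j - 1) div block_size = i - 1"
    using l(1) block_size_pos by (simp only: div_mult_self2) auto
  moreover have "j \<le> N"
  proof -
    have "j \<le> (i - 1) * block_size + block_size" using l by simp
    also have "\<dots> = i * block_size" using assms by (cases i) auto
    also have "\<dots> \<le> K * block_size" using assms by simp
    finally show ?thesis using N_eq by simp
  qed
  ultimately show "j \<in> {1..N} \<and> owner j = i"
    using l assms by (auto simp: owner_def)
next
  assume j: "j \<in> {1..N} \<and> owner j = i"
  then have "i - 1 = (j - 1) div block_size" "j \<ge> 1"
    by (auto simp: owner_def)
  then have "(i - 1) * block_size + ((j - 1) mod block_size + 1) = j"
    by (metis add.assoc div_mult_mod_eq le_add_diff_inverse2)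
  moreover have "(j - 1) mod block_size + 1 \<in> {1..block_size}"
    using block_size_pos mod_less_divisor[of block_size "j - 1"] by (simp add: Suc_le_eq)
  ultimately show "j \<in> processed K N i"
    unfolding processed_def by (metis imageI)
qed

lemma card_processed: "card (processed K N i) = block_size"
  unfolding processed_def by (subst card_image) (auto simp: inj_on_def)

section \<open>The converse bound\<close>

text \<open>\<open>p i\<close> is the position of worker \<open>i\<close>, counted from 1; the
  requested block belongs to the cyclically next worker, so the last one requests the block of the
  first.\<close>

definition shift_assignment :: "(nat \<Rightarrow> nat) \<Rightarrow> nat \<Rightarrow> nat set" where
  "shift_assignment p = (\<lambda>i\<in>{1..K}. processed K N (inv p (p i mod K + 1)))"

lemma shift_assignment_in:
  assumes p: "p permutes {1..K}"
  shows "shift_assignment p \<in> assignments K N"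
proof -
  define nxt where "nxt i = inv p (p i mod K + 1)" for i
  have nxt_in: "nxt i \<in> {1..K}" for i
    unfolding nxt_def using permutes_in_image[OF permutes_inv[OF p], of "p i mod K + 1"] K_pos
      mod_less_divisor[of K "p i"] by (auto simp: Suc_le_eq)
  have inj: "inj_on nxt {1..K}"
  proof (rule inj_onI)
    fix i j assume ij: "i \<in> {1..K}" "j \<in> {1..K}" "nxt i = nxt j"
    have "p i mod K = p j mod K"
      using ij(3) permutes_inj[OF permutes_inv[OF p]] by (auto simp: nxt_def inj_def)
    moreover have "p i \<in> {1..K}" "p j \<in> {1..K}"
      using ij p by (simp_all only: permutes_in_image)
    ultimately have "p i = p j"
      by (cases "p i = K"; cases "p j = K") auto
    then show "i = j" using permutes_inj[OF p] by (auto simp: inj_def)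
  qed
  have surj: "nxt ` {1..K} = {1..K}"
    using nxt_in inj by (intro endo_inj_surj) auto
  have sh: "shift_assignment p i = processed K N (nxt i)" if "i \<in> {1..K}" for i
    using that by (simp add: shift_assignment_def nxt_def)
  have "(\<Union>i\<in>{1..K}. shift_assignment p i) = {1..N}"
  proof
    show "{1..N} \<subseteq> (\<Union>i\<in>{1..K}. shift_assignment p i)"
    proof
      fix j assume j: "j \<in> {1..N}"
      then obtain i where "i \<in> {1..K}" "nxt i = owner j"
        using surj owner_in[OF j] by (metis imageE)
      then show "j \<in> (\<Union>i\<in>{1..K}. shift_assignment p i)"
        using j nxt_in[of i] by (intro UN_I[of i]) (simp_all add: sh processed_iff)
    qed
  qed (use nxt_in in \<open>auto simp: sh processed_iff simp del: atLeastAtMost_iff\<close>)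
  moreover have "disjoint_family_on (shift_assignment p) {1..K}"
    unfolding disjoint_family_on_def
    using nxt_in inj_onD[OF inj] by (auto simp: sh processed_iff simp del: atLeastAtMost_iff)
  moreover have "shift_assignment p \<in> {1..K} \<rightarrow>\<^sub>E Pow {1..N}"
    unfolding shift_assignment_def
    using nxt_in[unfolded nxt_def] by (auto simp: processed_iff simp del: atLeastAtMost_iff)
  ultimately show ?thesis
    by (simp add: assignments_def sh card_processed)
qed

text \<open>The bits that become known only when the block containing them is decoded, if the caches are
  read in the order of the positions \<open>p i\<close>.\<close>

definition new_bits :: "nat \<Rightarrow> (nat \<Rightarrow> nat \<Rightarrow> nat set) \<Rightarrow> (nat \<Rightarrow> nat) \<Rightarrow> (nat \<times> nat) set" where
  "new_bits B P p = {(j, b). j \<in> {1..N} \<and> b < B \<and> p (owner j) \<noteq> 1 \<and>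
     (\<forall>i\<in>{1..K} - {owner j}. b \<in> P i j \<longrightarrow> p (owner j) < p i)}"

lemma finite_new_bits: "finite (new_bits B P p)"
  by (rule finite_subset[of _ "{1..N} \<times> {..<B}"]) (auto simp: new_bits_def)

text \<open>Each set of new bits is encoded as files equal to its indicator. The broadcast is
  injective on these files, so two to the number of new bits is at most
  \<open>2 ^ L\<close>.\<close>

lemma card_new_bits_le:
  assumes p: "p permutes {1..K}" and P: "uncoded_placement K N S B P"
    and X: "delivery K N B P (shift_assignment p) L X"
  shows "card (new_bits B P p) \<le> L"
proof -
  define contents where "contents s = (\<lambda>j\<in>{1..N}. map (\<lambda>b. (j, b) \<in> s) [0..<B])" for s
  have contents_in: "contents s \<in> file_contents N B" for s
    by (auto simp: contents_def file_contents_def)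
  have contents_nth: "contents s j ! b \<longleftrightarrow> (j, b) \<in> s" if "j \<in> {1..N}" "b < B" for s j b
    using that by (simp add: contents_def)
  \<comment> \<open>Files that vanish outside the new bits are decoded in the order of their owners.\<close>
  have eq: "contents s j = contents t j"
    if st: "s \<subseteq> new_bits B P p" "t \<subseteq> new_bits B P p" and Xeq: "X (contents s) = X (contents t)"
      and "j \<in> {1..N}" for s t j
    using \<open>j \<in> {1..N}\<close>
  proof (induction "p (owner j)" arbitrary: j rule: less_induct)
    case less
    define m where "m = p (owner j)"
    have m: "m \<in> {1..K}"
      unfolding m_def using p owner_in[OF less.prems] by (simp only: permutes_in_image)
    show ?case
    proof (cases "m = 1")
      case True
      \<comment> \<open>The first block contains no new bits, so both contents vanish on it.\<close>
      then have "(j, b) \<notin> s \<and> (j, b) \<notin> t" for b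
        using st by (auto simp: new_bits_def m_def)
      then show ?thesis by (simp add: contents_def)
    next
      case False
      \<comment> \<open>The predecessor of the owner of \<open>j\<close>: it is the worker that
        requests \<open>j\<close>.\<close>
      define i where "i = inv p (m - 1)"
      have pi: "p i = m - 1"
        unfolding i_def by (rule permutes_inverses[OF p])
      have i: "i \<in> {1..K}"
        using permutes_in_image[OF p, of i] pi m False by auto
      have "inv p (p i mod K + 1) = owner j"
      proof -
        have "p i < K" "p i + 1 = m" using m False pi by auto
        then have "p i mod K + 1 = m" by simp
        then show ?thesis by (simp add: m_def permutes_inverses(2)[OF p])
      qed
      then have "j \<in> shift_assignment p i"
        using i less.prems owner_in[OF less.prems] by (simp add: shift_assignment_def processed_iff)
      moreover have "cache_content K N P i (contents s) = cache_content K N P i (contents t)"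
        unfolding cache_content_eq_iff
      proof (intro conjI ballI)
        fix j' assume "j' \<in> processed K N i"
        then show "contents s j' = contents t j'"
          using less.hyps[of j'] i pi m False by (auto simp: processed_iff m_def)
      next
        fix j' b assume j': "j' \<in> {1..N} - processed K N i" and b: "b \<in> P i j'"
        have "b < B" using P i j' b by (force simp: uncoded_placement_def)
        show "contents s j' ! b = contents t j' ! b"
        proof (cases "p (owner j') < m")
          case True
          then show ?thesis using less.hyps[of j'] j' by (auto simp: m_def)
        next
          case False
          have "\<not> p (owner j') < p i" using False pi by simp
          moreover have "i \<noteq> owner j'" using i j' by (auto simp: processed_iff)
          \<comment> \<open>A bit cached by \<open>i\<close> whose owner does not precede
            \<open>i\<close> is not new, hence it is zero in both contents.\<close>
          ultimately have "(j', b) \<notin> new_bits B P p"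
            using i b by (auto simp: new_bits_def)
          then show ?thesis
            using st j' \<open>b < B\<close> by (auto simp: contents_nth)
        qed
      qed
      ultimately show ?thesis
        using X i Xeq contents_in unfolding delivery_iff by blast
    qed
  qed
  have "inj_on (\<lambda>s. X (contents s)) (Pow (new_bits B P p))"
  proof (rule inj_onI)
    fix s t assume st: "s \<in> Pow (new_bits B P p)" "t \<in> Pow (new_bits B P p)" "X (contents s) = X (contents t)"
    have "(j, b) \<in> s \<longleftrightarrow> (j, b) \<in> t" if "(j, b) \<in> new_bits B P p" for j b
    proof -
      have "j \<in> {1..N}" "b < B" using that by (auto simp: new_bits_def)
      moreover from this have "contents s j = contents t j" using st by (intro eq) auto
      ultimately show ?thesis by (metis contents_nth)
    qed
    then show "s = t" using st by auto
  qed
  then have "card (Pow (new_bits B P p)) \<le> card {bs :: bool list. set bs \<subseteq> UNIV \<and> length bs = L}"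
    using X contents_in by (intro card_inj_on_le finite_lists_length_eq) (auto simp: delivery_def)
  then have "(2 :: nat) ^ card (new_bits B P p) \<le> 2 ^ L"
    by (subst (asm) card_lists_length_eq) (simp_all add: card_Pow finite_new_bits)
  then show ?thesis by simp
qed

text \<open>The owner must precede all \<open>h\<close> holders, which happens in a proportion
  1/(h+1) of the orders. Among these, the orders with the owner first of all, a proportion 1/K, are
  excluded.\<close>

lemma card_orders_new_bit:
  fixes P :: "nat \<Rightarrow> nat \<Rightarrow> nat set"
  assumes j: "j \<in> {1..N}" "b < B"
  defines "h \<equiv> card {i \<in> {1..K} - {owner j}. b \<in> P i j}"
  shows "real (card {p. p permutes {1..K} \<and> (j, b) \<in> new_bits B P p})
    = fact K * (1 / (real h + 1) - 1 / real K)"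
proof -
  define E where "E G = {p. p permutes {1..K} \<and> (\<forall>g\<in>G. p (owner j) < p g)}" for G
  define H where "H = {i \<in> {1..K} - {owner j}. b \<in> P i j}"
  note o = owner_in[OF j(1)]
  have card_E: "real (card (E G)) = fact K / (real (card G) + 1)" if "G \<subseteq> {1..K} - {owner j}" for G
  proof -
    have "card (E G) * (card G + 1) = fact K"
      unfolding E_def using card_permutes_first[of "{1..K}" G "owner j"] that o by auto
    then have "real (card (E G)) * (real (card G) + 1) = fact K"
      by (metis of_nat_1 of_nat_add of_nat_fact of_nat_mult)
    then show ?thesis by (simp add: field_simps)
  qed
  have first: "p (owner j) = 1 \<longleftrightarrow> (\<forall>g\<in>{1..K} - {owner j}. p (owner j) < p g)"
    if p: "p permutes {1..K}" for p
  proof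
    assume 1: "p (owner j) = 1"
    show "\<forall>g\<in>{1..K} - {owner j}. p (owner j) < p g"
    proof
      fix g assume g: "g \<in> {1..K} - {owner j}"
      then have "p g \<in> {1..K}" using permutes_in_image[OF p, of g] by simp
      moreover have "p g \<noteq> p (owner j)" using g permutes_inj[OF p] by (auto simp: inj_def)
      ultimately show "p (owner j) < p g" using 1 by auto
    qed
  next
    assume less: "\<forall>g\<in>{1..K} - {owner j}. p (owner j) < p g"
    have "p (inv p 1) = 1" by (rule permutes_inverses[OF p])
    moreover from this have "inv p 1 \<in> {1..K}"
      using permutes_in_image[OF p, of "inv p 1"] K_pos by auto
    moreover have "p (owner j) \<in> {1..K}" using permutes_in_image[OF p] o by simp
    ultimately show "p (owner j) = 1"
      using less[rule_format, of "inv p 1"] by (cases "inv p 1 = owner j") auto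
  qed
  have "{p. p permutes {1..K} \<and> (j, b) \<in> new_bits B P p} = E H - E ({1..K} - {owner j})"
    using j first by (auto simp: new_bits_def E_def H_def)
  moreover have "E ({1..K} - {owner j}) \<subseteq> E H" by (auto simp: E_def H_def)
  moreover have "finite (E G)" for G
    unfolding E_def by (rule finite_subset[OF _ finite_permutations[of "{1..K}"]]) auto
  ultimately have "real (card {p. p permutes {1..K} \<and> (j, b) \<in> new_bits B P p})
      = real (card (E H)) - real (card (E ({1..K} - {owner j})))"
    by (simp add: card_Diff_subset card_mono of_nat_diff)
  also have "real (card (E H)) = fact K / (real h + 1)"
    unfolding h_def H_def[symmetric] by (rule card_E) (auto simp: H_def)
  also have "real (card (E ({1..K} - {owner j}))) = fact K / real K"
    using card_E[of "{1..K} - {owner j}"] o K_pos by (simp add: of_nat_diff)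
  finally show ?thesis by (simp add: algebra_simps)
qed

text \<open>Double counting of the pairs of a bit and a non-owner caching it: summed by worker, each
  contributes at most its excess storage.\<close>

lemma sum_holders_le:
  assumes P: "uncoded_placement K N (real s * real block_size) B P"
  shows "(\<Sum>(j, b)\<in>{1..N} \<times> {..<B}. real (card {i \<in> {1..K} - {owner j}. b \<in> P i j}))
    \<le> real N * (real s - 1) * real B"
proof -
  have NK: "real N = real K * real block_size"
    using N_eq by (metis of_nat_mult)
  have card_eq: "real (card {i \<in> {1..K} - {owner j}. b \<in> P i j})
      = (\<Sum>i\<in>{1..K}. of_bool (i \<noteq> owner j \<and> b \<in> P i j))" for j b
  proof -
    have "{i \<in> {1..K} - {owner j}. b \<in> P i j} = {1..K} \<inter> {i. i \<noteq> owner j \<and> b \<in> P i j}" by auto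
    then show ?thesis by (simp add: sum_of_bool_eq)
  qed
  have excess: "(\<Sum>j\<in>{1..N}. \<Sum>b<B. of_bool (i \<noteq> owner j \<and> b \<in> P i j))
      \<le> (real s - 1) * real block_size * real B" if i: "i \<in> {1..K}" for i
  proof -
    have diff: "{1..N} - processed K N i = {j \<in> {1..N}. i \<noteq> owner j}"
      using i by (auto simp: processed_iff)
    have "(\<Sum>j\<in>{1..N}. \<Sum>b<B. of_bool (i \<noteq> owner j \<and> b \<in> P i j) :: real)
        = (\<Sum>j\<in>{1..N}. if i \<noteq> owner j then real (card (P i j)) else 0)"
    proof (intro sum.cong refl)
      fix j assume j: "j \<in> {1..N}"
      show "(\<Sum>b<B. of_bool (i \<noteq> owner j \<and> b \<in> P i j) :: real)
          = (if i \<noteq> owner j then real (card (P i j)) else 0)"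
      proof (cases "i = owner j")
        case False
        then have "j \<in> {1..N} - processed K N i" using j i by (simp add: processed_iff)
        then have "P i j \<subseteq> {..<B}"
          using P i unfolding uncoded_placement_def by blast
        then have "{..<B} \<inter> {b. b \<in> P i j} = P i j" by auto
        then show ?thesis using False by (simp add: sum_of_bool_eq)
      qed simp
    qed
    also have "\<dots> = real (\<Sum>j\<in>{1..N} - processed K N i. card (P i j))"
      unfolding diff of_nat_sum by (rule sum.inter_filter[symmetric]) simp
    also have "\<dots> \<le> (real s * real block_size - real N / real K) * real B"
      using P i by (simp add: uncoded_placement_def)
    also have "real N / real K = real block_size"
      using NK K_pos by simp
    finally show ?thesis by (simp add: algebra_simps)
  qed
  have "(\<Sum>(j, b)\<in>{1..N} \<times> {..<B}. real (card {i \<in> {1..K} - {owner j}. b \<in> P i j}))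
      = (\<Sum>j\<in>{1..N}. \<Sum>b<B. \<Sum>i\<in>{1..K}. of_bool (i \<noteq> owner j \<and> b \<in> P i j))"
    unfolding card_eq by (simp add: sum.cartesian_product)
  also have "\<dots> = (\<Sum>j\<in>{1..N}. \<Sum>i\<in>{1..K}. \<Sum>b<B. of_bool (i \<noteq> owner j \<and> b \<in> P i j))"
    by (intro sum.cong refl sum.swap)
  also have "\<dots> = (\<Sum>i\<in>{1..K}. \<Sum>j\<in>{1..N}. \<Sum>b<B. of_bool (i \<noteq> owner j \<and> b \<in> P i j))"
    by (rule sum.swap)
  also have "\<dots> \<le> (\<Sum>i\<in>{1..K}. (real s - 1) * real block_size * real B)"
    by (intro sum_mono excess)
  also have "\<dots> = real N * (real s - 1) * real B"
    using NK by simp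
  finally show ?thesis .
qed

text \<open>Convexity: the right-hand side is the tangent of 1/x at \<open>s\<close>, and the gap is
  a square over a positive number.\<close>

lemma tangent_inverse:
  fixes x s :: real
  assumes "x > 0" "s > 0"
  shows "1 / x \<ge> 1 / s - (x - s) / s\<^sup>2"
proof -
  have "1 / x - (1 / s - (x - s) / s\<^sup>2) = (x - s)\<^sup>2 / (x * s\<^sup>2)"
    using assms by (simp add: field_simps power2_eq_square)
  moreover have "\<dots> \<ge> 0" using assms by simp
  ultimately show ?thesis by linarith
qed

lemma worst_case_lower_bound:
  assumes P: "uncoded_placement K N (real s * real block_size) B P" and "B > 0" "s > 0"
  shows "real N * (1 / real s - 1 / real K) \<le> Max (min_load K N B P ` assignments K N)"
proof -
  define M where "M = Max (min_load K N B P ` assignments K N)"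
  define U where "U = {1..N} \<times> {..<B}"
  define W where "W = {p :: nat \<Rightarrow> nat. p permutes {1..K}}"
  define h where "h j b = real (card {i \<in> {1..K} - {owner j}. b \<in> P i j})" for j b
  have finW: "finite W" unfolding W_def by (rule finite_permutations) simp
  have card_U: "card U = N * B" by (simp add: U_def card_cartesian_product)
  have new_le: "real (card (new_bits B P p)) \<le> real B * M" if "p \<in> W" for p
  proof -
    have p: "p permutes {1..K}" using that by (simp add: W_def)
    obtain L X where X: "delivery K N B P (shift_assignment p) L X"
        "min_load K N B P (shift_assignment p) = real L / real B"
      using min_load_attained[OF \<open>B > 0\<close> shift_assignment_in[OF p]] .
    have "real (card (new_bits B P p)) \<le> real L"
      using card_new_bits_le[OF p P X(1)] by simp
    also have "real L = real B * min_load K N B P (shift_assignment p)"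
      using X(2) \<open>B > 0\<close> by simp
    also have "\<dots> \<le> real B * M"
      unfolding M_def using shift_assignment_in[OF p] finite_assignments
      by (intro mult_left_mono Max_ge) auto
    finally show ?thesis .
  qed
  \<comment> \<open>The tangent is taken at \<open>s\<close> because the storage bound makes the
    average of \<open>h j b + 1\<close> at most \<open>s\<close>; its slope is negative, so this
    upper bound on the average suffices.\<close>
  have "real N * real B * (1 / real s - 1 / real K)
      \<le> (\<Sum>(j, b)\<in>U. 1 / real s - (h j b + 1 - real s) / (real s)\<^sup>2 - 1 / real K)"
  proof -
    have "(\<Sum>(j, b)\<in>U. h j b) \<le> real N * (real s - 1) * real B"
      using sum_holders_le[OF P] by (simp add: U_def h_def)
    then have "((\<Sum>(j, b)\<in>U. h j b) + real (N * B) * (1 - real s)) / (real s)\<^sup>2 \<le> 0"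
      using \<open>s > 0\<close> by (intro divide_nonpos_nonneg) (auto simp: algebra_simps)
    moreover have "(\<Sum>(j, b)\<in>U. 1 / real s - (h j b + 1 - real s) / (real s)\<^sup>2 - 1 / real K)
        = real (N * B) * (1 / real s - 1 / real K)
          - ((\<Sum>(j, b)\<in>U. h j b) + real (N * B) * (1 - real s)) / (real s)\<^sup>2"
    proof -
      have "(\<Sum>(j, b)\<in>U. 1 / real s - (h j b + 1 - real s) / (real s)\<^sup>2 - 1 / real K)
          = (\<Sum>x\<in>U. (1 / real s - 1 / real K)
              - ((case x of (j, b) \<Rightarrow> h j b) + (1 - real s)) / (real s)\<^sup>2)"
        by (intro sum.cong refl) (auto simp: algebra_simps)
      then show ?thesis
        by (simp add: sum_subtractf sum_divide_distrib[symmetric] sum.distrib card_U)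
    qed
    ultimately show ?thesis by simp
  qed
  also have "\<dots> \<le> (\<Sum>(j, b)\<in>U. 1 / (h j b + 1) - 1 / real K)"
    using tangent_inverse[of "h _ _ + 1" "real s"] \<open>s > 0\<close>
    by (intro sum_mono) (auto simp: h_def)
  finally have "fact K * (real N * real B * (1 / real s - 1 / real K))
      \<le> fact K * (\<Sum>(j, b)\<in>U. 1 / (h j b + 1) - 1 / real K)"
    by (rule mult_left_mono) simp
  also have "\<dots> = (\<Sum>x\<in>U. real (card {p \<in> W. x \<in> new_bits B P p}))"
    unfolding sum_distrib_left
  proof (intro sum.cong refl)
    fix x assume x: "x \<in> U"
    obtain j b where [simp]: "x = (j, b)" by (cases x)
    show "fact K * (case x of (j, b) \<Rightarrow> 1 / (h j b + 1) - 1 / real K)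
        = real (card {p \<in> W. x \<in> new_bits B P p})"
      using card_orders_new_bit[of j b B P] x by (simp add: U_def W_def h_def)
  qed
  \<comment> \<open>Incidences of bits and orders are now counted by order instead of by
    bit.\<close>
  also have "\<dots> = (\<Sum>x\<in>U. \<Sum>p\<in>W. of_bool (x \<in> new_bits B P p))"
    using finW by (simp add: sum_of_bool_eq Int_def)
  also have "\<dots> = (\<Sum>p\<in>W. \<Sum>x\<in>U. of_bool (x \<in> new_bits B P p))"
    by (rule sum.swap)
  also have "\<dots> = (\<Sum>p\<in>W. real (card (new_bits B P p)))"
  proof (intro sum.cong refl)
    fix p
    have "U \<inter> {x. x \<in> new_bits B P p} = new_bits B P p" by (auto simp: U_def new_bits_def)
    then show "(\<Sum>x\<in>U. of_bool (x \<in> new_bits B P p)) = real (card (new_bits B P p))"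
      by (simp add: sum_of_bool_eq U_def)
  qed
  also have "\<dots> \<le> (\<Sum>p\<in>W. real B * M)"
    by (intro sum_mono new_le)
  also have "\<dots> = fact K * (real B * M)"
    using card_permutations[of "{1..K}" K] by (simp add: W_def)
  finally have "real B * (real N * (1 / real s - 1 / real K)) \<le> real B * M"
    by (simp add: mult_ac)
  then show ?thesis using \<open>B > 0\<close> by (simp add: M_def)
qed

section \<open>The coded delivery\<close>

text \<open>\<open>e k b\<close> is the set of non-owners meant to cache bit \<open>b\<close> of
  each file owned by \<open>k\<close>; all files of a block share one labelling.\<close>

definition labelling :: "nat \<Rightarrow> nat \<Rightarrow> (nat \<Rightarrow> nat \<Rightarrow> nat set) \<Rightarrow> bool" where
  "labelling s B e \<longleftrightarrow>
     (\<forall>k\<in>{1..K}. bij_betw (e k) {..<B} {A. A \<subseteq> {1..K} - {k} \<and> card A = s - 1})"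

lemma labelling_exists: "\<exists>e. labelling s ((K - 1) choose (s - 1)) e"
proof -
  have "\<exists>e. bij_betw e {..<(K - 1) choose (s - 1)} {A. A \<subseteq> {1..K} - {k} \<and> card A = s - 1}"
    if "k \<in> {1..K}" for k
  proof (rule finite_same_card_bij)
    show "card {..<(K - 1) choose (s - 1)} = card {A. A \<subseteq> {1..K} - {k} \<and> card A = s - 1}"
      using that by (subst n_subsets) auto
  qed auto
  then show ?thesis unfolding labelling_def by metis
qed

definition label_placement :: "nat \<Rightarrow> (nat \<Rightarrow> nat \<Rightarrow> nat set) \<Rightarrow> nat \<Rightarrow> nat \<Rightarrow> nat set" where
  "label_placement B e i j = {b. b < B \<and> i \<in> e (owner j) b}"

text \<open>\<open>e\<close> maps these positions bijectively onto the (s-1)-sets of non-owners that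
  contain \<open>i\<close>.\<close>

lemma card_label_placement:
  assumes e: "labelling s B e" and B: "B = (K - 1) choose (s - 1)"
    and j: "j \<in> {1..N}" and i: "i \<in> {1..K}" "i \<noteq> owner j"
  shows "(K - 1) * card (label_placement B e i j) = (s - 1) * B"
proof -
  let ?o = "owner j"
  have bij: "bij_betw (e ?o) {..<B} {A. A \<subseteq> {1..K} - {?o} \<and> card A = s - 1}"
    using e owner_in[OF j] by (simp add: labelling_def)
  have "e ?o ` label_placement B e i j = {A. A \<subseteq> {1..K} - {?o} \<and> card A = s - 1 \<and> i \<in> A}"
    using bij_betw_imp_surj_on[OF bij] unfolding label_placement_def by blast
  moreover have "inj_on (e ?o) (label_placement B e i j)"
    using bij_betw_imp_inj_on[OF bij] by (rule inj_on_subset) (auto simp: label_placement_def)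
  ultimately have "card (label_placement B e i j)
      = card {A. A \<subseteq> {1..K} - {?o} \<and> card A = s - 1 \<and> i \<in> A}"
    by (metis card_image)
  then show ?thesis
    using card_subsets_containing[of "{1..K} - {?o}" i "s - 1"] i owner_in[OF j] B by simp
qed

text \<open>For \<open>K > 1\<close> the excess storage is filled exactly: a proportion (s-1)/(K-1)
  of each of the \<open>(K - 1) * block_size\<close> foreign files. For \<open>K = 1\<close> there
  are no foreign files.\<close>

lemma label_placement_uncoded:
  assumes e: "labelling s B e" and B: "B = (K - 1) choose (s - 1)" and "s \<ge> 1"
  shows "uncoded_placement K N (real s * real block_size) B (label_placement B e)"
  unfolding uncoded_placement_def
proof (intro ballI conjI)
  fix i j
  show "label_placement B e i j \<subseteq> {..<B}" by (auto simp: label_placement_def)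
next
  fix i assume i: "i \<in> {1..K}"
  have NK: "real N = real K * real block_size"
    using N_eq by (metis of_nat_mult)
  let ?V = "{1..N} - processed K N i"
  have "processed K N i \<subseteq> {1..N}" using i by (auto simp: processed_iff)
  then have card_V: "card ?V = (K - 1) * block_size"
    using card_processed[of i] N_eq finite_subset[of "processed K N i" "{1..N}"]
    by (simp add: card_Diff_subset diff_mult_distrib)
  show "real (\<Sum>j\<in>?V. card (label_placement B e i j))
      \<le> (real s * real block_size - real N / real K) * real B"
  proof (cases "K = 1")
    case True
    then have "?V = {}" using card_V by simp
    then have "(\<Sum>j\<in>?V. card (label_placement B e i j)) = 0" by (simp only: sum.empty)
    then show ?thesis
      using NK K_pos mult_right_mono[of 1 "real s" "real block_size"] \<open>s \<ge> 1\<close>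
      by (simp del: mult_cancel_right1)
  next
    case False
    have "(K - 1) * (\<Sum>j\<in>?V. card (label_placement B e i j)) = (\<Sum>j\<in>?V. (s - 1) * B)"
      unfolding sum_distrib_left
      using i by (intro sum.cong refl card_label_placement[OF e B]) (auto simp: processed_iff)
    also have "\<dots> = (K - 1) * (block_size * (s - 1) * B)"
      by (simp add: card_V del: One_nat_def)
    finally have "(\<Sum>j\<in>?V. card (label_placement B e i j)) = block_size * (s - 1) * B"
      using False K_pos by simp
    then have "real (\<Sum>j\<in>?V. card (label_placement B e i j)) = real block_size * (real s - 1) * real B"
      using \<open>s \<ge> 1\<close> by (simp add: of_nat_diff)
    then show ?thesis
      using NK K_pos by (simp add: algebra_simps)
  qed
qed

text \<open>The requests are split into \<open>block_size\<close> rounds with one file per worker;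
  each round broadcasts one bit for every \<open>s\<close>-set of workers avoiding
  \<open>K\<close>.\<close>

lemma coded_delivery:
  assumes e: "labelling s B e" and "s \<ge> 1" and d: "d \<in> assignments K N"
  shows "\<exists>X. delivery K N B (label_placement B e) d (block_size * ((K - 1) choose s)) X"
proof -
  let ?W = "{1..K}"
  let ?P = "label_placement B e"
  have d_sub: "d i \<subseteq> {1..N}" and d_card: "card (d i) = block_size" if "i \<in> ?W" for i
    using d that by (auto simp: assignments_def PiE_iff)
  have "\<exists>g. bij_betw g {1..block_size} (d i)" if "i \<in> ?W" for i
    using d_sub[OF that] d_card[OF that]
    by (intro finite_same_card_bij) (auto intro: finite_subset)
  then obtain g where g: "\<And>i. i \<in> ?W \<Longrightarrow> bij_betw (g i) {1..block_size} (d i)" by metis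
  define r where "r l i = g i l" for l i
  have r_in: "r l i \<in> {1..N}" if "i \<in> ?W" "l \<in> {1..block_size}" for l i
    using g d_sub that unfolding r_def by (blast dest: bij_betwE)
  \<comment> \<open>The bit of \<open>f\<close> with label \<open>A\<close>, with default 0 when
    \<open>A\<close> labels no bit of \<open>f\<close>.\<close>
  define v :: "(nat \<Rightarrow> bool list) \<Rightarrow> nat \<Rightarrow> nat set \<Rightarrow> bit"
    where "v F f A = of_bool (\<exists>b<B. e (owner f) b = A \<and> F f ! b)" for F f A
  define y where "y F = (\<lambda>(l, D). boundary ?W (group_sum owner (r l) (v F)) D)" for F
  define Y where "Y = {1..block_size} \<times> {D. D \<subseteq> ?W - {K} \<and> card D = s}"
  have "finite Y" unfolding Y_def by auto
  then obtain ys where ys: "set ys = Y" "distinct ys" using finite_distinct_list by metis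
  have "card {D. D \<subseteq> ?W - {K} \<and> card D = s} = (K - 1) choose s"
    using K_pos by (subst n_subsets) auto
  then have "card Y = block_size * ((K - 1) choose s)"
    by (simp add: Y_def card_cartesian_product)
  then have len: "length ys = block_size * ((K - 1) choose s)"
    using ys distinct_card by metis
  define X where "X F = map (\<lambda>x. y F x = 1) ys" for F
  have "F j = F' j"
    if i: "i \<in> ?W" and j: "j \<in> d i" and F: "F \<in> file_contents N B" "F' \<in> file_contents N B"
      and X_eq: "X F = X F'" and Z_eq: "cache_content K N ?P i F = cache_content K N ?P i F'"
    for i j F F'
  proof (cases "owner j = i")
    case True
    then show ?thesis
      using Z_eq i j d_sub[OF i] by (auto simp: cache_content_eq_iff processed_iff)
  next
    case False
    have jN: "j \<in> {1..N}" using j d_sub[OF i] by auto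
    obtain l where l: "l \<in> {1..block_size}" "r l i = j"
      using g[OF i] j unfolding r_def by (metis bij_betw_imp_surj_on imageE)
    \<comment> \<open>The difference over GF(2) of two realizations that worker \<open>i\<close>
      cannot tell apart; it remains to show that it vanishes on the requested file.\<close>
    define w where "w f A = v F f A + v F' f A" for f A
    have cached: "F f ! b = F' f ! b"
      if "f \<in> {1..N}" "b < B" "owner f = i \<or> i \<in> e (owner f) b" for f b
    proof (cases "owner f = i")
      case True
      then show ?thesis using Z_eq that(1) i by (auto simp: cache_content_eq_iff processed_iff)
    next
      case False
      then show ?thesis using Z_eq that i
        by (auto simp: cache_content_eq_iff processed_iff label_placement_def)
    qed
    have known: "w (r l k) A = 0" if "k \<in> ?W" "owner (r l k) = i \<or> i \<in> A" for k A
    proof -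
      have "v F (r l k) A = v F' (r l k) A"
        unfolding v_def using cached[OF r_in[OF that(1) l(1)]] that(2) by (metis (no_types, lifting))
      then show ?thesis by (simp add: w_def bit_add_self)
    qed
    have sent: "boundary ?W (group_sum owner (r l) w) D = 0"
      if "D \<subseteq> ?W - {K}" "card D = s" for D
    proof -
      have "(l, D) \<in> set ys" using that l ys by (simp add: Y_def)
      then have "(y F (l, D) = 1) = (y F' (l, D) = 1)"
        using X_eq by (auto simp: X_def)
      then have "y F (l, D) = y F' (l, D)"
        by (metis bit_not_one_iff)
      then show ?thesis
        unfolding w_def boundary_group_sum_add by (simp add: y_def bit_add_self)
    qed
    \<comment> \<open>The boundary at \<open>s\<close>-sets through \<open>K\<close> is not sent,
      but it follows from what is sent.\<close>
    have all_zero: "boundary ?W (group_sum owner (r l) w) D = 0"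
      if "D \<subseteq> ?W" "card D = s" for D
    proof (rule boundary_zero_extend)
      show "K \<in> ?W" using K_pos by simp
    qed (fact finite_atLeastAtMost that sent)+
    show ?thesis
    proof (rule nth_equalityI)
      show "length (F j) = length (F' j)" using F jN by (simp add: length_file)
    next
      fix b assume "b < length (F j)"
      then have b: "b < B" using F jN by (simp add: length_file)
      show "F j ! b = F' j ! b"
      proof (cases "i \<in> e (owner j) b")
        case True
        then show ?thesis using cached jN b by blast
      next
        case False
        let ?G = "e (owner j) b"
        have bij: "bij_betw (e (owner j)) {..<B} {A. A \<subseteq> ?W - {owner j} \<and> card A = s - 1}"
          using e owner_in[OF jN] by (simp add: labelling_def)
        then have G: "?G \<subseteq> ?W - {owner j}" "card ?G = s - 1"
          using b bij_betwE by fastforce+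
        have v_G: "v H j ?G = of_bool (H j ! b)" for H
          unfolding v_def using bij_betw_imp_inj_on[OF bij] b by (auto dest: inj_onD)
        have "finite ?G" using G finite_subset by blast
        then have "boundary ?W (group_sum owner (r l) w) (insert i ?G) = 0"
          using G False i \<open>s \<ge> 1\<close> K_pos by (intro all_zero) auto
        moreover have "boundary ?W (group_sum owner (r l) w) (insert i ?G) = w (r l i) ?G"
          using i \<open>owner j \<noteq> i\<close> owner_in[OF jN] G False known l
          by (intro boundary_group_sum_single) auto
        ultimately have "of_bool (F j ! b) + of_bool (F' j ! b) = (0 :: bit)"
          using l by (simp add: w_def v_G)
        then show ?thesis by (cases "F j ! b"; cases "F' j ! b") auto
      qed
    qed
  qed
  then have "delivery K N B ?P d (block_size * ((K - 1) choose s)) X"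
    unfolding delivery_iff using len by (intro conjI ballI impI) (simp add: X_def, blast)
  then show ?thesis by blast
qed

end

section \<open>The two bounds combined\<close>

theorem theorem5:
  fixes K N Shat :: nat and S :: real
  assumes "K \<ge> 1" and "N \<ge> 1" and "K dvd N"
    and "S / (real N / real K) = real Shat"
    and "Shat \<in> {1..K}"
  shows "R_worst_case K N S =
    real N / real K * (real ((K - 1) choose Shat) / real ((K - 1) choose (Shat - 1)))"
proof -
  interpret shuffling K N using assms by unfold_locales
  define B where "B = (K - 1) choose (Shat - 1)"
  define R where "R = real N / real K * (real ((K - 1) choose Shat) / real B)"
  have "B > 0" using assms(5) by (auto simp: B_def)
  have NK: "real N / real K = real block_size"
    using K_dvd_N by (simp add: real_of_nat_div)
  then have S: "S = real Shat * real block_size"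
    using assms(4) block_size_pos by (simp add: field_simps)
  have R_eq: "R = real N * (1 / real Shat - 1 / real K)"
  proof -
    \<comment> \<open>By Pascal's rule the bracket is \<open>K choose Shat\<close>, so this is the
      absorption identity.\<close>
    have "K * B = (B + ((K - 1) choose Shat)) * Shat"
    proof -
      obtain m t where "K = Suc m" "Shat = Suc t"
        using assms(1,5) by (cases K; cases Shat) auto
      then show ?thesis
        using Suc_times_binomial_eq[of m t] by (simp add: B_def)
    qed
    then have "real K * real B = (real B + real ((K - 1) choose Shat)) * real Shat"
      by (metis of_nat_add of_nat_mult)
    then have "real ((K - 1) choose Shat) / real B = (real K - real Shat) / real Shat"
      using \<open>B > 0\<close> assms(5) by (simp add: field_simps)
    then have "R = real N / real K * ((real K - real Shat) / real Shat)"
      by (simp only: R_def)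
    then show ?thesis
      using assms(1,5) by (simp add: field_simps)
  qed
  have lower: "R \<le> Max (min_load K N B' P ` assignments K N)"
    if "B' > 0" "uncoded_placement K N S B' P" for B' P
    unfolding R_eq using that assms(5) by (intro worst_case_lower_bound) (auto simp: S)
  obtain e where e: "labelling Shat B e" using labelling_exists unfolding B_def by blast
  define P where "P = label_placement B e"
  have P: "uncoded_placement K N S B P"
    unfolding P_def S using e assms(5) by (intro label_placement_uncoded) (auto simp: B_def)
  have "Max (min_load K N B P ` assignments K N) \<le> R"
  proof (rule Max.boundedI)
    \<comment> \<open>Some assignment must exist for the maximum to be bounded by its
      members.\<close>
    have "shift_assignment id \<in> assignments K N"
      by (rule shift_assignment_in) (rule permutes_id)
    then show "min_load K N B P ` assignments K N \<noteq> {}" by blast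
  next
    fix x assume "x \<in> min_load K N B P ` assignments K N"
    then obtain d where d: "d \<in> assignments K N" "x = min_load K N B P d" by blast
    obtain X where "delivery K N B P d (block_size * ((K - 1) choose Shat)) X"
      using coded_delivery[OF e _ d(1)] assms(5) by (auto simp: P_def)
    from min_load_le[OF this] show "x \<le> R"
      by (simp add: d(2) R_def NK)
  qed (simp add: finite_assignments)
  with lower[OF \<open>B > 0\<close> P] have "R = Max (min_load K N B P ` assignments K N)" by simp
  \<comment> \<open>The lower bound holds for every placement and is attained at \<open>P\<close>,
    so the infimum is a minimum.\<close>
  then have "R_worst_case K N S = R"
    unfolding R_worst_case_def using \<open>B > 0\<close> P lower
    by (intro cInf_eq_minimum) auto
  then show ?thesis by (simp add: R_def B_def)
qed

end
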